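(* Let $G$ be a Burnside group, i.e. an infinite, finitely generated group in which every element has finite order, and let $S=\{a_1,a_2,\dots,a_m\}$ be a generating set of $G$. Let $X$ be the infinite-dimensional real vector space of formal finite sums $\sum c_i g_i$ with $c_i\in\mathbb{R}$, $g_i\in G$, with the inner product defined by $\|g_i\|=2^{|g_i|_S}$ and $\langle g_i,g_j\rangle=0$ if $g_i\ne g_j$, and let $\mathcal{H}$ be the Hilbert space obtained by completing $X$ in this norm. Then the natural action $\alpha:G\to B(\mathcal{H})$ given by left multiplication on $X$ satisfies $\|\alpha(g)\|_{B(\mathcal{H})}=2^{|g|_S}$ for every $g\in G$. The corresponding cocycle $\mathcal{A}$ over the shift on $S^{\mathbb{Z}}$, $\mathcal{A}((b_i)_{i\in\mathbb{Z}})=\alpha(b_0)$, satisfies $\chi_{\mathrm{top}}=\log 2$, but $\chi_\mu=0$ for every shift-invariant probability measure $\mu$ supported on a periodic orbit.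
   Context: $|g|_S$ denotes the word length of $g\in G$ with respect to the generating set $S$, and $B(\mathcal{H})$ is the algebra of bounded operators on $\mathcal{H}$ with the operator norm. The shift is $\sigma((b_i)_{i\in\mathbb{Z}})=(b_{i+1})_{i\in\mathbb{Z}}$ on $S^{\mathbb{Z}}$, and $\mathcal{A}^n(x)=\mathcal{A}(\sigma^{n-1}x)\cdots\mathcal{A}(\sigma x)\mathcal{A}(x)$ for $n\ge1$. The exponents are understood in the standard sense: the top exponent of the cocycle is $$\chi_{\mathrm{top}}=\lim_{n\to\infty}\frac1n\log\sup_{x\in S^{\mathbb{Z}}}\|\mathcal{A}^n(x)\|,$$ and for a shift-invariant probability measure $\mu$ the top Lyapunov exponent is $$\chi_\mu=\lim_{n\to\infty}\frac1n\int\log\|\mathcal{A}^n(x)\|\,d\mu(x).$$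
   Formalization: The word length |g|_S counts words in the letters of S only, without inverses of generators (the usual length if S is symmetric); with inverses allowed, χ_top = log 2 fails, e.g. for the Gupta–Sidki 3-group with S = {a, t}. *)

theory Defs
  imports
    "HOL-Probability.Probability"
    "HOL-Algebra.Generated_Groups"
    "HOL-Library.Poly_Mapping"
begin

section \<open>Burnside groups and word length\<close>

definition burnside_group :: "('g, 'b) monoid_scheme \<Rightarrow> bool" where
  "burnside_group G \<longleftrightarrow>
     group G \<and> infinite (carrier G) \<and>
     (\<exists>T. finite T \<and> T \<subseteq> carrier G \<and> generate G T = carrier G) \<and>
     (\<forall>g\<in>carrier G. \<exists>n>0. g [^]\<^bsub>G\<^esub> (n::nat) = \<one>\<^bsub>G\<^esub>)"

text \<open>
  Words are written in the letters of \<open>S\<close> alone. If all elements of \<open>G\<close> have finite order, every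
  \<open>g\<close> in the group generated by \<open>S\<close> is such a word, so the minimum is over a nonempty set. If \<open>S\<close>
  is closed under inverses, this is the usual word length. If it is not, formal inverses must not
  be admitted, because the cocycle over \<open>S\<close> multiplies letters of \<open>S\<close> only: with formal inverses,
  the Gupta--Sidki group with its two generators \<open>a\<close>, \<open>t\<close> of order 3 has no long geodesic word in
  the letters \<open>a\<close>, \<open>t\<close> (it would have to alternate, since \<open>a a\<close> is the inverse of \<open>a\<close>, but \<open>a t\<close>
  has finite order), and the top exponent would be smaller than \<open>ln 2\<close>.
\<close>

definition word_length :: "('g, 'b) monoid_scheme \<Rightarrow> 'g set \<Rightarrow> 'g \<Rightarrow> nat" where
  "word_length G S g =
     (LEAST n. \<exists>w. set w \<subseteq> S \<and> length w = n \<and> foldr (\<otimes>\<^bsub>G\<^esub>) w \<one>\<^bsub>G\<^esub> = g)"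

section \<open>Formal sums, their inner product, and the completion\<close>

definition formal_sums :: "('g, 'b) monoid_scheme \<Rightarrow> ('g \<Rightarrow>\<^sub>0 real) set" where
  "formal_sums G = {x. Poly_Mapping.keys x \<subseteq> carrier G}"

text \<open>The bilinear form for which distinct group elements are orthogonal and \<open>g\<close> has norm
  \<open>2 ^ word_length G S g\<close>.\<close>

definition formal_inner ::
    "('g, 'b) monoid_scheme \<Rightarrow> 'g set \<Rightarrow> ('g \<Rightarrow>\<^sub>0 real) \<Rightarrow> ('g \<Rightarrow>\<^sub>0 real) \<Rightarrow> real" where
  "formal_inner G S x y =
     (\<Sum>g\<in>Poly_Mapping.keys x.
        Poly_Mapping.lookup x g * Poly_Mapping.lookup y g * (2 ^ word_length G S g)\<^sup>2)"

definition left_mult :: "('g, 'b) monoid_scheme \<Rightarrow> 'g \<Rightarrow> ('g \<Rightarrow>\<^sub>0 real) \<Rightarrow> ('g \<Rightarrow>\<^sub>0 real)" where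
  "left_mult G g x =
     (\<Sum>h\<in>Poly_Mapping.keys x. Poly_Mapping.single (g \<otimes>\<^bsub>G\<^esub> h) (Poly_Mapping.lookup x h))"

text \<open>The weights depend on \<open>G\<close> and \<open>S\<close>, so the completion cannot be one fixed type. Instead, a
  complete inner product space \<open>'h\<close> together with a linear isometry of the formal sums onto a
  dense subspace is a completion; it is unique up to a unique isometric isomorphism.\<close>

definition is_completion ::
    "('g, 'b) monoid_scheme \<Rightarrow> 'g set \<Rightarrow> (('g \<Rightarrow>\<^sub>0 real) \<Rightarrow> 'h::{real_inner, complete_space}) \<Rightarrow> bool"
  where
  "is_completion G S \<iota> \<longleftrightarrow>
     (\<forall>x\<in>formal_sums G. \<forall>y\<in>formal_sums G. \<iota> (x + y) = \<iota> x + \<iota> y) \<and>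
     (\<forall>c. \<forall>x\<in>formal_sums G. \<iota> (Poly_Mapping.map ((*) c) x) = c *\<^sub>R \<iota> x) \<and>
     (\<forall>x\<in>formal_sums G. \<forall>y\<in>formal_sums G. inner (\<iota> x) (\<iota> y) = formal_inner G S x y) \<and>
     closure (\<iota> ` formal_sums G) = UNIV"

text \<open>By density there is at most one such operator; that there is one for \<open>g \<in> carrier G\<close> has to be
  proved.\<close>

definition left_action ::
    "('g, 'b) monoid_scheme \<Rightarrow> (('g \<Rightarrow>\<^sub>0 real) \<Rightarrow> 'h::{real_inner, complete_space}) \<Rightarrow> 'g \<Rightarrow> ('h \<Rightarrow>\<^sub>L 'h)"
  where
  "left_action G \<iota> g =
     (THE T. \<forall>x\<in>formal_sums G. blinfun_apply T (\<iota> x) = \<iota> (left_mult G g x))"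

section \<open>Cocycles over the shift\<close>

definition shift :: "(int \<Rightarrow> 'g) \<Rightarrow> (int \<Rightarrow> 'g)" where
  "shift b = (\<lambda>i. b (i + 1))"

definition action_cocycle :: "('g \<Rightarrow> ('h::real_normed_vector \<Rightarrow>\<^sub>L 'h)) \<Rightarrow> (int \<Rightarrow> 'g) \<Rightarrow> ('h \<Rightarrow>\<^sub>L 'h)" where
  "action_cocycle \<alpha> b = \<alpha> (b 0)"

primrec cocycle_iter ::
    "((int \<Rightarrow> 'g) \<Rightarrow> ('h::real_normed_vector \<Rightarrow>\<^sub>L 'h)) \<Rightarrow> nat \<Rightarrow> (int \<Rightarrow> 'g) \<Rightarrow> ('h \<Rightarrow>\<^sub>L 'h)" where
  "cocycle_iter A 0 x = id_blinfun"
| "cocycle_iter A (Suc n) x = A ((shift ^^ n) x) o\<^sub>L cocycle_iter A n x"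

definition has_top_exponent ::
    "'g set \<Rightarrow> ((int \<Rightarrow> 'g) \<Rightarrow> ('h::real_normed_vector \<Rightarrow>\<^sub>L 'h)) \<Rightarrow> real \<Rightarrow> bool" where
  "has_top_exponent S A l \<longleftrightarrow>
     (\<lambda>n. (1 / real n) * ln (SUP x\<in>(UNIV \<rightarrow> S). norm (cocycle_iter A n x))) \<longlonglongrightarrow> l"

text \<open>For finite \<open>S\<close> the product \<open>\<sigma>\<close>-algebra below is the Borel \<open>\<sigma>\<close>-algebra of the compact space of
  all sequences \<open>int \<Rightarrow> S\<close>.\<close>

definition shift_invariant_prob :: "'g set \<Rightarrow> (int \<Rightarrow> 'g) measure \<Rightarrow> bool" where
  "shift_invariant_prob S \<mu> \<longleftrightarrow>
     prob_space \<mu> \<and> sets \<mu> = sets (\<Pi>\<^sub>M i\<in>UNIV. count_space S) \<and> distr \<mu> \<mu> shift = \<mu>"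

definition supported_on_periodic_orbit :: "'g set \<Rightarrow> (int \<Rightarrow> 'g) measure \<Rightarrow> bool" where
  "supported_on_periodic_orbit S \<mu> \<longleftrightarrow>
     (\<exists>x\<in>UNIV \<rightarrow> S. \<exists>p>0. (shift ^^ p) x = x \<and> emeasure \<mu> {(shift ^^ k) x | k. k < p} = 1)"

text \<open>Integrability is required because the Bochner integral of a non-integrable function is 0.\<close>

definition has_lyapunov_exponent ::
    "(int \<Rightarrow> 'g) measure \<Rightarrow> ((int \<Rightarrow> 'g) \<Rightarrow> ('h::real_normed_vector \<Rightarrow>\<^sub>L 'h)) \<Rightarrow> real \<Rightarrow> bool" where
  "has_lyapunov_exponent \<mu> A l \<longleftrightarrow>
     (\<forall>n\<ge>1. integrable \<mu> (\<lambda>x. ln (norm (cocycle_iter A n x)))) \<and>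
     (\<lambda>n. (1 / real n) * (\<integral>x. ln (norm (cocycle_iter A n x)) \<partial>\<mu>)) \<longlonglongrightarrow> l"

end

theory Submission
  imports Defs
begin

text \<open>
  Left multiplication by \<open>g\<close> permutes the orthogonal basis of group elements. Since
  \<open>|g h| \<le> |g| + |h|\<close>, it stretches each basis vector by at most \<open>2 ^ |g|\<close>, and since it sends the
  unit vector \<open>\<one>\<close> to \<open>g\<close>, the bound is attained. Hence \<open>\<alpha>(g)\<close> has norm exactly \<open>2 ^ |g|\<close>, and all
  statements about exponents become statements about lengths of the group elements
  \<open>b\<^sub>n\<^sub>-\<^sub>1 \<dots> b\<^sub>1 b\<^sub>0\<close> spelled by the sequence \<open>b\<close>.

  The top exponent is \<open>ln 2\<close> because geodesic words of every length exist: a ball in the Cayley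
  graph is finite while \<open>G\<close> is infinite, so there are arbitrarily long geodesics, and pieces of
  geodesics are geodesic. This argument needs words in the letters of \<open>S\<close> alone to reach all of \<open>G\<close>,
  which holds as the inverse of an element of finite order is one of its powers.

  On a periodic orbit of period \<open>p\<close>, the element \<open>u\<close> spelled by one period has finite order \<open>m\<close>, so
  the spelled group elements repeat with period \<open>p m\<close>. Their lengths stay bounded, and dividing by
  \<open>n\<close> gives exponent 0.
\<close>

section \<open>Extension of bounded linear maps from a dense subspace\<close>

lemma blinfun_eq_on_dense:
  fixes T U :: "'a::real_normed_vector \<Rightarrow>\<^sub>L 'b::real_normed_vector"
  assumes "closure V = UNIV" and "\<And>v. v \<in> V \<Longrightarrow> blinfun_apply T v = blinfun_apply U v"
  shows "T = U"
proof (rule blinfun_eqI)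
  fix x
  have "blinfun_apply T x - blinfun_apply U x = 0"
    by (rule continuous_constant_on_closure[where S = V])
      (use assms in \<open>auto intro!: continuous_intros\<close>)
  then show "blinfun_apply T x = blinfun_apply U x" by simp
qed

lemma blinfun_extension_dense:
  fixes f :: "'a::real_normed_vector \<Rightarrow> 'b::{real_normed_vector, complete_space}"
  assumes V: "subspace V" "closure V = UNIV"
    and add: "\<And>x y. x \<in> V \<Longrightarrow> y \<in> V \<Longrightarrow> f (x + y) = f x + f y"
    and scale: "\<And>c x. x \<in> V \<Longrightarrow> f (c *\<^sub>R x) = c *\<^sub>R f x"
    and bound: "\<And>x. x \<in> V \<Longrightarrow> norm (f x) \<le> C * norm x" and "0 \<le> C"
  obtains T :: "'a \<Rightarrow>\<^sub>L 'b"
  where "\<And>x. x \<in> V \<Longrightarrow> blinfun_apply T x = f x" and "norm T \<le> C"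
proof -
  have "f x - f y = f (x - y)" if "x \<in> V" "y \<in> V" for x y
    using add[of x "(-1) *\<^sub>R y"] scale[of y "-1"] that V(1)
    by (simp add: subspace_neg)
  then have "C-lipschitz_on V f"
    using V(1) bound \<open>0 \<le> C\<close> by (intro lipschitz_onI) (auto simp: dist_norm subspace_diff)
  then obtain g where lip: "C-lipschitz_on UNIV g" and g: "\<And>x. x \<in> V \<Longrightarrow> g x = f x"
    using lipschitz_extend_closure[of C V f] V(2) by auto
  have cont: "continuous_on A g" for A
    using lip lipschitz_on_continuous_on continuous_on_subset by blast
  have g_add: "g (x + y) = g x + g y" for x y
  proof -
    have "(\<lambda>p. g (fst p + snd p) - g (fst p) - g (snd p)) (x, y) = 0"
    proof (rule continuous_constant_on_closure[where S = "V \<times> V"])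
      show "continuous_on (closure (V \<times> V)) (\<lambda>p. g (fst p + snd p) - g (fst p) - g (snd p))"
        by (intro continuous_intros continuous_on_compose2[OF cont]) auto
    qed (use V in \<open>auto simp: g add subspace_add closure_Times\<close>)
    then show ?thesis by (simp add: algebra_simps)
  qed
  have g_scale: "g (c *\<^sub>R x) = c *\<^sub>R g x" for c x
  proof -
    have "g (c *\<^sub>R x) - c *\<^sub>R g x = 0"
    proof (rule continuous_constant_on_closure[where S = V])
      show "continuous_on (closure V) (\<lambda>x. g (c *\<^sub>R x) - c *\<^sub>R g x)"
        by (intro continuous_intros continuous_on_compose2[OF cont]) auto
    qed (use V in \<open>auto simp: g scale subspace_scale\<close>)
    then show ?thesis by simp
  qed
  have "g 0 = 0" using g_scale[of 0 0] by simp
  then have g_bound: "norm (g x) \<le> C * norm x" for x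
    using lipschitz_onD[OF lip, of x 0] by (simp add: dist_norm)
  have "bounded_linear g"
    by (rule bounded_linear_intro[where K = C]) (use g_add g_scale g_bound in \<open>auto simp: mult.commute\<close>)
  then have "blinfun_apply (Blinfun g) = g" by (rule bounded_linear_Blinfun_apply)
  then show ?thesis
    using that[of "Blinfun g"] norm_blinfun_bound[of C "Blinfun g"] g g_bound \<open>0 \<le> C\<close> by simp
qed

section \<open>Length with respect to words in the generators\<close>

text \<open>In a torsion group, a word in the letters of \<open>S\<close> and their inverses can be replaced by a word
  in the letters of \<open>S\<close>.\<close>

lemma (in group) generate_by_positive_words:
  assumes "S \<subseteq> carrier G" and "\<And>g. g \<in> carrier G \<Longrightarrow> \<exists>n>0. g [^] (n::nat) = \<one>"
    and "g \<in> generate G S"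
  shows "\<exists>w. set w \<subseteq> S \<and> foldr (\<otimes>) w \<one> = g"
  using assms(3)
proof (induction rule: generate.induct)
  case one
  show ?case by (rule exI[of _ "[]"]) simp
next
  case (incl h)
  then show ?case using assms(1) by (intro exI[of _ "[h]"]) auto
next
  case (inv h)
  then have h: "h \<in> carrier G" using assms(1) by auto
  then obtain n where n: "h [^] Suc n = \<one>" using assms(2) by (metis gr0_conv_Suc)
  have "h \<otimes> h [^] k = h [^] k \<otimes> h" for k :: nat
    using nat_pow_Suc2[OF h, of k] by simp
  then have pow: "foldr (\<otimes>) (replicate k h) \<one> = h [^] k" for k
    by (induction k) auto
  have "inv h = h [^] n" using n h by (intro inv_equality) auto
  then show ?case using inv by (intro exI[of _ "replicate n h"]) (auto simp: pow simp del: foldr_replicate)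
next
  case (eng h1 h2)
  then obtain v w where vw: "set v \<subseteq> S" "foldr (\<otimes>) v \<one> = h1" "set w \<subseteq> S" "foldr (\<otimes>) w \<one> = h2"
    by blast
  have closed: "foldr (\<otimes>) u \<one> \<in> carrier G" if "set u \<subseteq> carrier G" for u
    using that by (induction u) auto
  have "foldr (\<otimes>) (u @ w) \<one> = foldr (\<otimes>) u \<one> \<otimes> foldr (\<otimes>) w \<one>" if "set u \<subseteq> carrier G" for u
    using that closed[of w] vw assms(1) by (induction u) (auto simp: m_assoc closed)
  then show ?case using vw assms(1) by (intro exI[of _ "v @ w"]) auto
qed

locale positively_generated_group = group G for G :: "('g, 'b) monoid_scheme" (structure) +
  fixes S :: "'g set"
  assumes letters_closed: "S \<subseteq> carrier G"
    and exists_word: "g \<in> carrier G \<Longrightarrow> \<exists>w. set w \<subseteq> S \<and> foldr (\<otimes>) w \<one> = g"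
begin

abbreviation word_product :: "'g list \<Rightarrow> 'g" where
  "word_product w \<equiv> foldr (\<otimes>) w \<one>"

lemma word_product_closed [simp]: "set w \<subseteq> S \<Longrightarrow> word_product w \<in> carrier G"
  using letters_closed by (induction w) auto

lemma word_product_append:
  "set v \<subseteq> S \<Longrightarrow> set w \<subseteq> S \<Longrightarrow> word_product (v @ w) = word_product v \<otimes> word_product w"
  using letters_closed by (induction v) (auto simp: m_assoc subset_iff)

lemma exists_geodesic_word:
  assumes "g \<in> carrier G"
  obtains w where "set w \<subseteq> S" and "length w = word_length G S g" and "word_product w = g"
proof -
  have "\<exists>n w. set w \<subseteq> S \<and> length w = n \<and> word_product w = g"
    using exists_word[OF assms] by auto
  from LeastI_ex[OF this] show ?thesis
    using that unfolding word_length_def by blast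
qed

lemma word_length_le: "set w \<subseteq> S \<Longrightarrow> word_length G S (word_product w) \<le> length w"
  unfolding word_length_def by (rule Least_le) auto

lemma word_length_one [simp]: "word_length G S \<one> = 0"
  using word_length_le[of "[]"] by simp

lemma word_length_mult_le:
  assumes "g \<in> carrier G" "h \<in> carrier G"
  shows "word_length G S (g \<otimes> h) \<le> word_length G S g + word_length G S h"
proof -
  obtain v where v: "set v \<subseteq> S" "length v = word_length G S g" "word_product v = g"
    using exists_geodesic_word[OF assms(1)] .
  obtain w where w: "set w \<subseteq> S" "length w = word_length G S h" "word_product w = h"
    using exists_geodesic_word[OF assms(2)] .
  show ?thesis
    using word_length_le[of "v @ w"] v w by (simp add: word_product_append del: foldr_append)
qed

lemma finite_ball:
  assumes "finite S"
  shows "finite {g \<in> carrier G. word_length G S g \<le> n}"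
proof (rule finite_subset)
  show "{g \<in> carrier G. word_length G S g \<le> n} \<subseteq> word_product ` {w. set w \<subseteq> S \<and> length w \<le> n}"
  proof
    fix g assume g: "g \<in> {g \<in> carrier G. word_length G S g \<le> n}"
    then obtain w where "set w \<subseteq> S" "length w = word_length G S g" "word_product w = g"
      using exists_geodesic_word[of g] by auto
    with g show "g \<in> word_product ` {w. set w \<subseteq> S \<and> length w \<le> n}" by auto
  qed
  show "finite (word_product ` {w. set w \<subseteq> S \<and> length w \<le> n})"
    using finite_lists_length_le[OF assms] by blast
qed

text \<open>Cut a geodesic word for an element outside the ball of radius \<open>n\<close> after \<open>n\<close> letters: if the
  beginning could be shortened, so could the whole word.\<close>

lemma exists_geodesic_word_of_length:
  assumes "finite S" "infinite (carrier G)"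
  obtains w where "set w \<subseteq> S" and "length w = n" and "word_length G S (word_product w) = n"
proof -
  have "\<not> carrier G \<subseteq> {g \<in> carrier G. word_length G S g \<le> n}"
    using finite_ball[OF assms(1)] assms(2) finite_subset by blast
  then obtain g where g: "g \<in> carrier G" "n < word_length G S g"
    by (auto simp: subset_iff not_le)
  obtain w where w: "set w \<subseteq> S" "length w = word_length G S g" "word_product w = g"
    using exists_geodesic_word[OF g(1)] .
  have sub: "set (take n w) \<subseteq> S" "set (drop n w) \<subseteq> S"
    using w(1) set_take_subset[of n w] set_drop_subset[of n w] by auto
  have "g = word_product (take n w) \<otimes> word_product (drop n w)"
    using word_product_append[OF sub] w(3) by simp
  then have "word_length G S g \<le> word_length G S (word_product (take n w)) + length (drop n w)"
    using word_length_mult_le[of "word_product (take n w)" "word_product (drop n w)"]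
      word_length_le[OF sub(2)] sub by simp
  moreover have "word_length G S (word_product (take n w)) \<le> n"
    using word_length_le[OF sub(1)] by simp
  ultimately show ?thesis
    using that[of "take n w"] sub(1) g(2) w(2) by simp
qed

end

section \<open>The norm of the action\<close>

context group
begin

lemma lookup_left_mult:
  assumes "g \<in> carrier G" "x \<in> formal_sums G"
  shows "Poly_Mapping.lookup (left_mult G g x) k =
    (if k \<in> carrier G then Poly_Mapping.lookup x (inv g \<otimes> k) else 0)"
proof -
  have sub: "Poly_Mapping.keys x \<subseteq> carrier G" using assms(2) by (simp add: formal_sums_def)
  have "Poly_Mapping.lookup (left_mult G g x) k =
      (\<Sum>h\<in>Poly_Mapping.keys x. if g \<otimes> h = k then Poly_Mapping.lookup x h else 0)"
    unfolding left_mult_def lookup_sum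
    by (intro sum.cong refl) (simp add: lookup_single when_def)
  also have "\<dots> = (\<Sum>h\<in>Poly_Mapping.keys x.
      if h = inv g \<otimes> k then if k \<in> carrier G then Poly_Mapping.lookup x h else 0 else 0)"
  proof (intro sum.cong refl)
    fix h assume "h \<in> Poly_Mapping.keys x"
    then have h: "h \<in> carrier G" using sub by auto
    have "g \<otimes> h = k \<longleftrightarrow> k \<in> carrier G \<and> h = inv g \<otimes> k"
      using assms(1) h by (metis inv_solve_left m_closed)
    then show "(if g \<otimes> h = k then Poly_Mapping.lookup x h else 0) =
      (if h = inv g \<otimes> k then if k \<in> carrier G then Poly_Mapping.lookup x h else 0 else 0)"
      by auto
  qed
  also have "\<dots> = (if k \<in> carrier G then Poly_Mapping.lookup x (inv g \<otimes> k) else 0)"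
    by (auto simp: sum.delta' sum.delta in_keys_iff)
  finally show ?thesis .
qed

lemma keys_left_mult:
  assumes "g \<in> carrier G" "x \<in> formal_sums G"
  shows "Poly_Mapping.keys (left_mult G g x) = (\<otimes>) g ` Poly_Mapping.keys x"
proof -
  have sub: "Poly_Mapping.keys x \<subseteq> carrier G" using assms(2) by (simp add: formal_sums_def)
  show ?thesis
  proof (intro equalityI subsetI)
    fix k assume "k \<in> Poly_Mapping.keys (left_mult G g x)"
    then have k: "k \<in> carrier G" "inv g \<otimes> k \<in> Poly_Mapping.keys x"
      by (auto simp: in_keys_iff lookup_left_mult[OF assms] split: if_splits)
    then have "k = g \<otimes> (inv g \<otimes> k)" using assms(1) by (simp add: m_assoc[symmetric])
    with k(2) show "k \<in> (\<otimes>) g ` Poly_Mapping.keys x" by blast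
  next
    fix k assume "k \<in> (\<otimes>) g ` Poly_Mapping.keys x"
    then obtain h where h: "h \<in> Poly_Mapping.keys x" "k = g \<otimes> h" by auto
    moreover have "inv g \<otimes> (g \<otimes> h) = h"
      using h sub assms(1) by (auto simp: m_assoc[symmetric])
    ultimately show "k \<in> Poly_Mapping.keys (left_mult G g x)"
      using sub assms(1) by (auto simp: in_keys_iff lookup_left_mult[OF assms])
  qed
qed

lemma left_mult_formal_sums:
  "g \<in> carrier G \<Longrightarrow> x \<in> formal_sums G \<Longrightarrow> left_mult G g x \<in> formal_sums G"
  using keys_left_mult by (fastforce simp: formal_sums_def)

lemma formal_sums_add: "x \<in> formal_sums G \<Longrightarrow> y \<in> formal_sums G \<Longrightarrow> x + y \<in> formal_sums G"
  using Poly_Mapping.keys_add[of x y] by (auto simp: formal_sums_def)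

lemma lookup_scale:
  fixes x :: "'c \<Rightarrow>\<^sub>0 real"
  shows "Poly_Mapping.lookup (Poly_Mapping.map ((*) c) x) k = c * Poly_Mapping.lookup x k"
  by (simp add: Poly_Mapping.map.rep_eq when_def)

lemma formal_sums_scale: "x \<in> formal_sums G \<Longrightarrow> Poly_Mapping.map ((*) c) x \<in> formal_sums G"
  by (auto simp: formal_sums_def in_keys_iff lookup_scale subset_iff)

lemma left_mult_add:
  "g \<in> carrier G \<Longrightarrow> x \<in> formal_sums G \<Longrightarrow> y \<in> formal_sums G \<Longrightarrow>
    left_mult G g (x + y) = left_mult G g x + left_mult G g y"
  by (rule poly_mapping_eqI) (simp add: lookup_left_mult formal_sums_add lookup_add)

lemma left_mult_scale:
  "g \<in> carrier G \<Longrightarrow> x \<in> formal_sums G \<Longrightarrow>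
    left_mult G g (Poly_Mapping.map ((*) c) x) = Poly_Mapping.map ((*) c) (left_mult G g x)"
  by (rule poly_mapping_eqI) (simp add: lookup_left_mult formal_sums_scale lookup_scale)

lemma left_mult_mult:
  assumes "g \<in> carrier G" "h \<in> carrier G" "x \<in> formal_sums G"
  shows "left_mult G (g \<otimes> h) x = left_mult G g (left_mult G h x)"
  by (rule poly_mapping_eqI)
    (use assms in \<open>simp add: lookup_left_mult left_mult_formal_sums inv_mult_group m_assoc\<close>)

lemma left_mult_one: "x \<in> formal_sums G \<Longrightarrow> left_mult G \<one> x = x"
  by (rule poly_mapping_eqI) (auto simp: lookup_left_mult formal_sums_def in_keys_iff subset_iff)

end

text \<open>Distinct basis vectors stay orthogonal under left multiplication, so the squared norms can be
  compared term by term, using \<open>|g h| \<le> |g| + |h|\<close>.\<close>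

lemma (in positively_generated_group) formal_inner_left_mult_le:
  assumes "g \<in> carrier G" "x \<in> formal_sums G"
  shows "formal_inner G S (left_mult G g x) (left_mult G g x)
    \<le> (2 ^ word_length G S g)\<^sup>2 * formal_inner G S x x"
proof -
  have sub: "Poly_Mapping.keys x \<subseteq> carrier G" using assms(2) by (simp add: formal_sums_def)
  have inj: "inj_on ((\<otimes>) g) (Poly_Mapping.keys x)"
    using sub assms(1) by (auto intro!: inj_onI simp: subset_iff)
  have cancel: "inv g \<otimes> (g \<otimes> h) = h" if "h \<in> carrier G" for h
    using that assms(1) by (simp add: m_assoc[symmetric])
  have "formal_inner G S (left_mult G g x) (left_mult G g x) =
      (\<Sum>h\<in>Poly_Mapping.keys x. (Poly_Mapping.lookup x h)\<^sup>2 * (2 ^ word_length G S (g \<otimes> h))\<^sup>2)"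
    unfolding formal_inner_def keys_left_mult[OF assms] sum.reindex[OF inj]
    by (intro sum.cong refl)
      (use sub assms in \<open>auto simp: lookup_left_mult cancel power2_eq_square\<close>)
  also have "\<dots> \<le> (\<Sum>h\<in>Poly_Mapping.keys x.
      (Poly_Mapping.lookup x h)\<^sup>2 * (2 ^ word_length G S g * 2 ^ word_length G S h)\<^sup>2)"
  proof (intro sum_mono mult_left_mono power_mono)
    fix h assume "h \<in> Poly_Mapping.keys x"
    then have "word_length G S (g \<otimes> h) \<le> word_length G S g + word_length G S h"
      using sub assms(1) word_length_mult_le by auto
    then show "(2::real) ^ word_length G S (g \<otimes> h) \<le> 2 ^ word_length G S g * 2 ^ word_length G S h"
      by (metis one_le_numeral power_add power_increasing)
  qed auto
  also have "\<dots> = (2 ^ word_length G S g)\<^sup>2 * formal_inner G S x x"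
    by (simp add: formal_inner_def sum_distrib_left power_mult_distrib power2_eq_square mult_ac)
  finally show ?thesis .
qed

locale group_completion = positively_generated_group G S
  for G :: "('g, 'b) monoid_scheme" (structure) and S :: "'g set" +
  fixes \<iota> :: "('g \<Rightarrow>\<^sub>0 real) \<Rightarrow> 'h::{real_inner, complete_space}"
  assumes completion: "is_completion G S \<iota>"
begin

lemma embedding_add:
  "x \<in> formal_sums G \<Longrightarrow> y \<in> formal_sums G \<Longrightarrow> \<iota> (x + y) = \<iota> x + \<iota> y"
  and embedding_scale: "x \<in> formal_sums G \<Longrightarrow> \<iota> (Poly_Mapping.map ((*) c) x) = c *\<^sub>R \<iota> x"
  and embedding_inner:
  "x \<in> formal_sums G \<Longrightarrow> y \<in> formal_sums G \<Longrightarrow> inner (\<iota> x) (\<iota> y) = formal_inner G S x y"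
  and embedding_dense: "closure (\<iota> ` formal_sums G) = UNIV"
  using completion by (auto simp: is_completion_def)

lemma embedding_norm: "x \<in> formal_sums G \<Longrightarrow> norm (\<iota> x) = sqrt (formal_inner G S x x)"
  by (simp add: norm_eq_sqrt_inner embedding_inner)

lemma embedding_subspace: "subspace (\<iota> ` formal_sums G)"
proof (rule subspaceI)
  have zero: "0 \<in> formal_sums G" by (simp add: formal_sums_def)
  then have "\<iota> 0 = 0" using embedding_add[of 0 0] by simp
  with zero show "0 \<in> \<iota> ` formal_sums G" by force
next
  fix u v assume "u \<in> \<iota> ` formal_sums G" "v \<in> \<iota> ` formal_sums G"
  then show "u + v \<in> \<iota> ` formal_sums G"
    by (auto simp: embedding_add[symmetric] formal_sums_add)
next
  fix c u assume "u \<in> \<iota> ` formal_sums G"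
  then show "c *\<^sub>R u \<in> \<iota> ` formal_sums G"
    by (auto simp: embedding_scale[symmetric] formal_sums_scale)
qed

text \<open>Injectivity makes the rule \<open>\<iota> x \<mapsto> \<iota> (g x)\<close> well defined on the dense subspace from which
  \<open>\<alpha>(g)\<close> is extended.\<close>

lemma embedding_inj: "inj_on \<iota> (formal_sums G)"
proof (rule inj_onI)
  fix x y assume xy: "x \<in> formal_sums G" "y \<in> formal_sums G" "\<iota> x = \<iota> y"
  define z where "z = x + Poly_Mapping.map ((*) (-1)) y"
  have z: "z \<in> formal_sums G" unfolding z_def by (intro formal_sums_add formal_sums_scale xy)
  have "\<iota> z = 0"
    unfolding z_def using xy by (simp only: embedding_add embedding_scale formal_sums_scale) simp
  then have "formal_inner G S z z = 0" using embedding_inner[OF z z] by simp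
  then have "\<forall>g\<in>Poly_Mapping.keys z.
      Poly_Mapping.lookup z g * Poly_Mapping.lookup z g * (2 ^ word_length G S g)\<^sup>2 = 0"
    unfolding formal_inner_def by (subst (asm) sum_nonneg_eq_0_iff) auto
  then have "Poly_Mapping.lookup z g = 0" for g
    by (cases "g \<in> Poly_Mapping.keys z") (auto simp: in_keys_iff)
  then show "x = y" by (intro poly_mapping_eqI) (auto simp: z_def lookup_add lookup_scale)
qed

lemma embedding_norm_left_mult_le:
  assumes "g \<in> carrier G" "x \<in> formal_sums G"
  shows "norm (\<iota> (left_mult G g x)) \<le> 2 ^ word_length G S g * norm (\<iota> x)"
proof -
  have "norm (\<iota> (left_mult G g x)) \<le> sqrt ((2 ^ word_length G S g)\<^sup>2 * formal_inner G S x x)"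
    using formal_inner_left_mult_le[OF assms] assms
    by (simp add: embedding_norm left_mult_formal_sums)
  then show ?thesis using assms(2) by (simp add: embedding_norm real_sqrt_mult)
qed

lemma left_action_eqI:
  assumes "\<And>x. x \<in> formal_sums G \<Longrightarrow> blinfun_apply T (\<iota> x) = \<iota> (left_mult G g x)"
  shows "left_action G \<iota> g = T"
  unfolding left_action_def
  by (rule the_equality) (use assms in \<open>auto intro!: blinfun_eq_on_dense[OF embedding_dense]\<close>)

lemma
  assumes g: "g \<in> carrier G"
  shows left_action_apply:
      "x \<in> formal_sums G \<Longrightarrow> blinfun_apply (left_action G \<iota> g) (\<iota> x) = \<iota> (left_mult G g x)"
    and norm_left_action_le: "norm (left_action G \<iota> g) \<le> 2 ^ word_length G S g"
proof -
  define f where "f u = \<iota> (left_mult G g (inv_into (formal_sums G) \<iota> u))" for u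
  have f: "f (\<iota> x) = \<iota> (left_mult G g x)" if "x \<in> formal_sums G" for x
    using that by (simp add: f_def inv_into_f_f[OF embedding_inj])
  have f_add: "f (u + v) = f u + f v" if "u \<in> \<iota> ` formal_sums G" "v \<in> \<iota> ` formal_sums G" for u v
    using that g
    by (auto simp: embedding_add[symmetric] f formal_sums_add left_mult_add left_mult_formal_sums)
  have f_scale: "f (c *\<^sub>R u) = c *\<^sub>R f u" if "u \<in> \<iota> ` formal_sums G" for c u
    using that g
    by (auto simp: embedding_scale[symmetric] f formal_sums_scale left_mult_scale
        left_mult_formal_sums)
  have f_bound: "norm (f u) \<le> 2 ^ word_length G S g * norm u" if "u \<in> \<iota> ` formal_sums G" for u
    using that g by (auto simp: f embedding_norm_left_mult_le)
  obtain T :: "'h \<Rightarrow>\<^sub>L 'h" where T: "\<And>u. u \<in> \<iota> ` formal_sums G \<Longrightarrow> blinfun_apply T u = f u"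
      "norm T \<le> 2 ^ word_length G S g"
    using blinfun_extension_dense[where f = f, OF embedding_subspace embedding_dense
        f_add f_scale f_bound] by auto
  have "left_action G \<iota> g = T" by (rule left_action_eqI) (simp add: T f)
  with T f show "norm (left_action G \<iota> g) \<le> 2 ^ word_length G S g"
    and "x \<in> formal_sums G \<Longrightarrow> blinfun_apply (left_action G \<iota> g) (\<iota> x) = \<iota> (left_mult G g x)"
    by auto
qed

lemma left_action_one: "left_action G \<iota> \<one> = id_blinfun"
  by (rule left_action_eqI) (simp add: left_mult_one)

lemma left_action_mult:
  "g \<in> carrier G \<Longrightarrow> h \<in> carrier G \<Longrightarrow>
    left_action G \<iota> (g \<otimes> h) = left_action G \<iota> g o\<^sub>L left_action G \<iota> h"
  by (rule left_action_eqI) (simp add: left_action_apply left_mult_mult left_mult_formal_sums)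

text \<open>The upper bound is attained at the unit vector \<open>\<one>\<close>, which is mapped to \<open>g\<close>.\<close>

lemma norm_left_action:
  assumes g: "g \<in> carrier G"
  shows "norm (left_action G \<iota> g) = 2 ^ word_length G S g"
proof (rule antisym[OF norm_left_action_le[OF g]])
  let ?e = "\<lambda>h. Poly_Mapping.single h (1::real)"
  have e: "?e h \<in> formal_sums G" "norm (\<iota> (?e h)) = 2 ^ word_length G S h" if "h \<in> carrier G" for h
  proof -
    show 1: "?e h \<in> formal_sums G" using that by (simp add: formal_sums_def)
    show "norm (\<iota> (?e h)) = 2 ^ word_length G S h"
      unfolding embedding_norm[OF 1] formal_inner_def by simp
  qed
  have "left_mult G g (?e \<one>) = ?e g" using g by (simp add: left_mult_def)
  then have "2 ^ word_length G S g = norm (blinfun_apply (left_action G \<iota> g) (\<iota> (?e \<one>)))"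
    using g by (simp add: left_action_apply e)
  also have "\<dots> \<le> norm (left_action G \<iota> g) * norm (\<iota> (?e \<one>))" by (rule norm_blinfun)
  finally show "2 ^ word_length G S g \<le> norm (left_action G \<iota> g)" by (simp add: e)
qed

end

section \<open>The cocycle along a sequence of letters\<close>

text \<open>The letters are reversed because \<open>\<A>\<^sup>n(x) = \<A>(\<sigma>\<^sup>n\<^sup>-\<^sup>1 x) \<cdots> \<A>(x)\<close> multiplies later ones from
  the left.\<close>

definition spelled_word :: "nat \<Rightarrow> (int \<Rightarrow> 'g) \<Rightarrow> 'g list" where
  "spelled_word n x = map (\<lambda>i. x (int i)) (rev [0..<n])"

lemma spelled_word_0 [simp]: "spelled_word 0 x = []"
  and spelled_word_Suc [simp]: "spelled_word (Suc n) x = x (int n) # spelled_word n x"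
  and length_spelled_word [simp]: "length (spelled_word n x) = n"
  by (simp_all add: spelled_word_def)

lemma set_spelled_word: "x \<in> UNIV \<rightarrow> S \<Longrightarrow> set (spelled_word n x) \<subseteq> S"
  by (auto simp: spelled_word_def)

lemma funpow_shift: "(shift ^^ n) x i = x (i + int n)"
  by (induction n arbitrary: i) (simp_all add: shift_def algebra_simps)

lemma spelled_word_add: "spelled_word (m + n) x = spelled_word n ((shift ^^ m) x) @ spelled_word m x"
  by (induction n) (simp_all add: funpow_shift algebra_simps)

lemma exists_spelling:
  assumes "set w \<subseteq> S" "S \<noteq> {}"
  obtains x where "x \<in> UNIV \<rightarrow> S" and "spelled_word (length w) x = w"
proof -
  obtain s where s: "s \<in> S" using assms(2) by auto
  define x where
    "x i = (if 0 \<le> i \<and> i < int (length w) then rev w ! nat i else s)" for i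
  have "rev w ! k \<in> S" if "k < length w" for k
    using nth_mem[of k "rev w"] that assms(1) by auto
  then have "x \<in> UNIV \<rightarrow> S" using s by (auto simp: x_def)
  moreover have "map (\<lambda>i. x (int i)) [0..<length w] = rev w"
    by (rule nth_equalityI) (auto simp: x_def)
  then have "spelled_word (length w) x = w"
    by (simp add: spelled_word_def rev_map[symmetric])
  ultimately show ?thesis using that by blast
qed

context positively_generated_group
begin

text \<open>If \<open>u\<close> is the element spelled by one period \<open>p\<close> and \<open>u\<^sup>m = \<one>\<close>, then the spelled elements repeat
  with period \<open>p m\<close>, so \<open>p m\<close> bounds their lengths.\<close>

lemma word_length_periodic_bounded:
  assumes x: "x \<in> UNIV \<rightarrow> S" and p: "(shift ^^ p) x = x" "0 < p"
    and torsion: "\<And>g. g \<in> carrier G \<Longrightarrow> \<exists>n>0. g [^] (n::nat) = \<one>"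
  shows "\<exists>C. \<forall>n. word_length G S (word_product (spelled_word n x)) \<le> C"
proof -
  let ?P = "\<lambda>n. word_product (spelled_word n x)"
  have closed: "?P n \<in> carrier G" for n using set_spelled_word[OF x] by simp
  obtain m :: nat where m: "0 < m" "?P p [^] m = \<one>" using torsion[OF closed[of p]] by blast
  have step: "?P (p + n) = ?P n \<otimes> ?P p" for n
    using word_product_append[OF set_spelled_word[OF x] set_spelled_word[OF x]] p(1)
    by (simp add: spelled_word_add del: foldr_append)
  have powers: "?P (k * p + n) = ?P n \<otimes> ?P p [^] k" for k n
  proof (induction k)
    case (Suc k)
    have "?P (Suc k * p + n) = ?P (p + (k * p + n))" by (simp add: add.assoc)
    also have "\<dots> = ?P n \<otimes> ?P p [^] k \<otimes> ?P p" by (simp only: step Suc)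
    finally show ?case by (simp add: m_assoc closed)
  qed (simp add: closed)
  have period: "?P (m * p + n) = ?P n" for n
    using powers[of m n] m closed by simp
  have "?P (k * (m * p) + n) = ?P n" for k n
  proof (induction k)
    case (Suc k)
    then show ?case using period[of "k * (m * p) + n"] by (simp add: add.assoc)
  qed simp
  then have reduce: "?P n = ?P (n mod (m * p))" for n
    by (metis div_mult_mod_eq)
  have "word_length G S (?P n) \<le> m * p" for n
  proof -
    have "word_length G S (?P n) \<le> n mod (m * p)"
      using reduce[of n] word_length_le[OF set_spelled_word[OF x], of "n mod (m * p)"] by simp
    also have "\<dots> \<le> m * p" using m p by (intro less_imp_le mod_less_divisor) simp
    finally show ?thesis .
  qed
  then show ?thesis by blast
qed

lemma measurable_spelled_product:
  assumes "finite S"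
  shows "(\<lambda>x. word_product (spelled_word n x)) \<in>
    measurable (\<Pi>\<^sub>M i\<in>(UNIV::int set). count_space S) (count_space (carrier G))"
proof (induction n)
  case 0
  show ?case by simp
next
  case (Suc n)
  have "(\<lambda>x. s \<otimes> word_product (spelled_word n x)) \<in>
      measurable (\<Pi>\<^sub>M i\<in>(UNIV::int set). count_space S) (count_space (carrier G))" if "s \<in> S" for s
    by (rule measurable_compose[OF Suc]) (use that letters_closed in auto)
  then have "(\<lambda>x. x (int n) \<otimes> word_product (spelled_word n x)) \<in>
      measurable (\<Pi>\<^sub>M i\<in>(UNIV::int set). count_space S) (count_space (carrier G))"
    by (rule measurable_compose_countable'[where g = "\<lambda>x. x (int n)" and I = S])
      (use assms in \<open>auto simp: countable_finite\<close>)
  then show ?case by simp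
qed

end

context group_completion
begin

text \<open>As \<open>\<alpha>\<close> is multiplicative, \<open>\<A>\<^sup>n(x)\<close> is \<open>\<alpha>\<close> of the group element spelled by \<open>x\<close>.\<close>

lemma norm_cocycle_iter:
  assumes x: "x \<in> UNIV \<rightarrow> S"
  shows "norm (cocycle_iter (action_cocycle (left_action G \<iota>)) n x) =
    2 ^ word_length G S (word_product (spelled_word n x))"
proof -
  have "cocycle_iter (action_cocycle (left_action G \<iota>)) n x =
      left_action G \<iota> (word_product (spelled_word n x))"
  proof (induction n)
    case (Suc n)
    have "x (int n) \<in> carrier G" using x letters_closed by auto
    with Suc set_spelled_word[OF x, of n] show ?case
      by (simp add: action_cocycle_def funpow_shift left_action_mult)
  qed (simp add: left_action_one)
  then show ?thesis using set_spelled_word[OF x] by (simp add: norm_left_action)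
qed

lemma has_top_exponent_left_action:
  assumes "finite S" "infinite (carrier G)"
  shows "has_top_exponent S (action_cocycle (left_action G \<iota>)) (ln 2)"
proof -
  have "S \<noteq> {}"
    using exists_geodesic_word_of_length[OF assms, of 1]
    by (metis length_0_conv set_empty subset_empty zero_neq_one)
  have sup: "(SUP x\<in>(UNIV \<rightarrow> S). norm (cocycle_iter (action_cocycle (left_action G \<iota>)) n x)) = 2 ^ n"
    for n
  proof (rule cSup_eq_maximum)
    obtain w where w: "set w \<subseteq> S" "length w = n" "word_length G S (word_product w) = n"
      using exists_geodesic_word_of_length[OF assms] .
    obtain x where x: "x \<in> UNIV \<rightarrow> S" "spelled_word n x = w"
      using exists_spelling[OF w(1) \<open>S \<noteq> {}\<close>] w(2) by blast
    then have "2 ^ n = norm (cocycle_iter (action_cocycle (left_action G \<iota>)) n x)"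
      using w(3) by (simp add: norm_cocycle_iter)
    with x(1) show "2 ^ n \<in>
        (\<lambda>x. norm (cocycle_iter (action_cocycle (left_action G \<iota>)) n x)) ` (UNIV \<rightarrow> S)"
      by blast
  next
    fix y assume "y \<in> (\<lambda>x. norm (cocycle_iter (action_cocycle (left_action G \<iota>)) n x)) ` (UNIV \<rightarrow> S)"
    then obtain x where x: "x \<in> UNIV \<rightarrow> S"
      and y: "y = norm (cocycle_iter (action_cocycle (left_action G \<iota>)) n x)" by auto
    show "y \<le> 2 ^ n"
      unfolding y norm_cocycle_iter[OF x]
      using word_length_le[OF set_spelled_word[OF x], of n] by simp
  qed
  show ?thesis
    unfolding has_top_exponent_def sup
    by (rule tendsto_eventually, rule eventually_mono[OF eventually_gt_at_top[of 0]])
      (simp add: ln_realpow)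
qed

text \<open>The orbit consists of finitely many periodic points, each with a bounded sequence of lengths,
  and carries the whole mass of \<open>\<mu>\<close>. So the integrals are bounded in \<open>n\<close>.\<close>

lemma has_lyapunov_exponent_periodic:
  assumes "finite S" and torsion: "\<And>g. g \<in> carrier G \<Longrightarrow> \<exists>n>0. g [^] (n::nat) = \<one>"
    and inv: "shift_invariant_prob S \<mu>" and supp: "supported_on_periodic_orbit S \<mu>"
  shows "has_lyapunov_exponent \<mu> (action_cocycle (left_action G \<iota>)) 0"
proof -
  let ?l = "\<lambda>n x. word_length G S (word_product (spelled_word n x))"
  let ?f = "\<lambda>n x. ln (norm (cocycle_iter (action_cocycle (left_action G \<iota>)) n x))"
  interpret prob_space \<mu> using inv by (simp add: shift_invariant_prob_def)
  have sets: "sets \<mu> = sets (\<Pi>\<^sub>M i\<in>UNIV. count_space S)"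
    using inv by (simp add: shift_invariant_prob_def)
  then have space: "space \<mu> = UNIV \<rightarrow> S"
    using sets_eq_imp_space_eq[OF sets] by (simp add: space_PiM PiE_def)
  have f: "?f n x = real (?l n x) * ln 2" if "x \<in> UNIV \<rightarrow> S" for n x
    using that by (simp add: norm_cocycle_iter ln_realpow)
  have meas: "?f n \<in> borel_measurable \<mu>" for n
  proof -
    have "(\<lambda>x. real (?l n x) * ln 2) \<in> borel_measurable (\<Pi>\<^sub>M i\<in>(UNIV::int set). count_space S)"
      by (rule measurable_compose[OF measurable_spelled_product[OF \<open>finite S\<close>]]) simp
    then have "(\<lambda>x. real (?l n x) * ln 2) \<in> borel_measurable \<mu>"
      using measurable_cong_sets[OF sets refl] by blast
    then show ?thesis using f space by (subst measurable_cong) auto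
  qed
  have integrable: "integrable \<mu> (?f n)" for n
  proof (rule integrable_const_bound[where B = "real n * ln 2"])
    show "AE x in \<mu>. norm (?f n x) \<le> real n * ln 2"
      using word_length_le[OF set_spelled_word, of _ n]
      by (intro AE_I2) (simp add: space f)
  qed (rule meas)
  obtain x p where x: "x \<in> UNIV \<rightarrow> S" and p: "0 < p" "(shift ^^ p) x = x"
    and full: "emeasure \<mu> {(shift ^^ k) x | k. k < p} = 1"
    using supp unfolding supported_on_periodic_orbit_def by blast
  define orbit where "orbit = {(shift ^^ k) x | k. k < p}"
  have "finite orbit" by (simp add: orbit_def)
  have ae: "AE y in \<mu>. y \<in> orbit"
    using full AE_in_set_eq_1[of orbit] emeasure_notin_sets[of orbit \<mu>]
    unfolding orbit_def[symmetric] by (cases "orbit \<in> sets \<mu>") (auto simp: measure_def)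
  have "\<exists>C. \<forall>n. ?l n y \<le> C" if "y \<in> orbit" for y
  proof -
    from that obtain k where k: "y = (shift ^^ k) x" by (auto simp: orbit_def)
    have "(shift ^^ p) y = (shift ^^ k) ((shift ^^ p) x)"
      by (simp add: k funpow_add[symmetric, THEN fun_cong, unfolded o_def] add.commute)
    then show ?thesis
      using x p torsion
      by (intro word_length_periodic_bounded[where p = p]) (auto simp: k funpow_shift)
  qed
  then obtain C where C: "\<And>y n. y \<in> orbit \<Longrightarrow> ?l n y \<le> C y" by metis
  define B where "B = (\<Sum>y\<in>orbit. C y)"
  have B: "?l n y \<le> B" if "y \<in> orbit" for n y
    using C[OF that, of n] member_le_sum[OF that, of C] \<open>finite orbit\<close> by (simp add: B_def)
  have int_bound: "\<bar>\<integral>y. ?f n y \<partial>\<mu>\<bar> \<le> real B * ln 2" for n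
  proof -
    have "(\<integral>y. ?f n y \<partial>\<mu>) \<le> (\<integral>y. real B * ln 2 \<partial>\<mu>)"
    proof (rule integral_mono_AE[OF integrable])
      show "AE y in \<mu>. ?f n y \<le> real B * ln 2"
        using ae AE_space by eventually_elim (auto simp: space f B)
    qed simp
    moreover have "0 \<le> (\<integral>y. ?f n y \<partial>\<mu>)"
      by (rule integral_nonneg_AE) (auto simp: space f)
    ultimately show ?thesis by (simp add: prob_space)
  qed
  have "(\<lambda>n. (1 / real n) * (\<integral>y. ?f n y \<partial>\<mu>)) \<longlonglongrightarrow> 0"
  proof (rule Lim_null_comparison)
    show "\<forall>\<^sub>F n in sequentially. norm ((1 / real n) * (\<integral>y. ?f n y \<partial>\<mu>)) \<le> (real B * ln 2) / real n"
      using int_bound by (intro always_eventually allI) (simp add: abs_mult divide_right_mono)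
    show "(\<lambda>n. (real B * ln 2) / real n) \<longlonglongrightarrow> 0" by (rule lim_const_over_n)
  qed
  then show ?thesis unfolding has_lyapunov_exponent_def using integrable by blast
qed

end

section \<open>Burnside groups\<close>

theorem mainTheorem3:
  fixes G :: "('g, 'b) monoid_scheme"
    and S :: "'g set"
    and \<iota> :: "('g \<Rightarrow>\<^sub>0 real) \<Rightarrow> 'h::{real_inner, complete_space}"
  assumes "burnside_group G"
    and "finite S" and "S \<subseteq> carrier G" and "generate G S = carrier G"
    and "is_completion G S \<iota>"
  defines "\<alpha> \<equiv> left_action G \<iota>"
  shows "(\<forall>g\<in>carrier G. \<forall>x\<in>formal_sums G. blinfun_apply (\<alpha> g) (\<iota> x) = \<iota> (left_mult G g x)) \<and>
    \<alpha> \<one>\<^bsub>G\<^esub> = id_blinfun \<and>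
    (\<forall>g\<in>carrier G. \<forall>h\<in>carrier G. \<alpha> (g \<otimes>\<^bsub>G\<^esub> h) = \<alpha> g o\<^sub>L \<alpha> h) \<and>
    (\<forall>g\<in>carrier G. norm (\<alpha> g) = 2 ^ word_length G S g) \<and>
    has_top_exponent S (action_cocycle \<alpha>) (ln 2) \<and>
    (\<forall>\<mu>. shift_invariant_prob S \<mu> \<and> supported_on_periodic_orbit S \<mu> \<longrightarrow>
       has_lyapunov_exponent \<mu> (action_cocycle \<alpha>) 0)"
proof -
  interpret group G using assms(1) by (simp add: burnside_group_def)
  have inf: "infinite (carrier G)"
    and torsion: "\<And>g. g \<in> carrier G \<Longrightarrow> \<exists>n>0. g [^]\<^bsub>G\<^esub> (n::nat) = \<one>\<^bsub>G\<^esub>"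
    using assms(1) by (auto simp: burnside_group_def)
  interpret group_completion G S \<iota>
  proof unfold_locales
    show "\<exists>w. set w \<subseteq> S \<and> foldr (\<otimes>\<^bsub>G\<^esub>) w \<one>\<^bsub>G\<^esub> = g" if "g \<in> carrier G" for g
      using generate_by_positive_words[OF assms(3) torsion] that assms(4) by simp
  qed (use assms in auto)
  show ?thesis
    unfolding \<alpha>_def
    using left_action_apply left_action_one left_action_mult norm_left_action
      has_top_exponent_left_action[OF assms(2) inf]
      has_lyapunov_exponent_periodic[OF assms(2) torsion] by blast
qed

end
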